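(* Consider the transformed second-stage program, for a first-stage decision $x\in\mathcal X$ and realization $\vartheta$ of the exogenous random vector, $$\min\{t_1(x,\widetilde q^{\top})y:\ t_3(x,\widetilde T)x+t_4(x,\widetilde W)y\ge t_2(x,\widetilde h),\ y\in\mathcal Y\},$$ in which each random element $\boldsymbol\xi^u_x$ is obtained by the inverse transformation $\boldsymbol\xi_x^u=t(x,\boldsymbol\vartheta_u)=\mathbb F^{-1}_{\boldsymbol\xi^u}(x,\beta)(\boldsymbol\vartheta_u)$ with $\boldsymbol\vartheta_u\sim U(0,1)$. Suppose that: (1) the cost vector $q$, the technology matrix $T$ and the recourse matrix $W$ are fixed (deterministic and independent of $x$), so that $t_1(x,\widetilde q^{\top})=q^{\top}$, $t_3(x,\widetilde T)=T$, $t_4(x,\widetilde W)=W$, and only the right-hand side vector $h$ has random elements; (2) for each $u$ and for fixed $x$ and $\beta$, the conditional marginal cumulative distribution function $\mathbb F_{\boldsymbol\xi^u}(x,\beta)(\cdot)$ is continuous and strictly increasing; (3) for each $u$, the transformation $t(x,\vartheta_u)=\mathbb F^{-1}_{\boldsymbol\xi^u}(x,\beta)(\vartheta_u)$ is a convex function of $x$ on (the continuous relaxation of) $\mathcal X$ for each realization $\vartheta_u$; or a concave function of $x$ if the recourse constraint of the second-stage program is instead a less-than-or-equal inequality, i.e. $t_3(x,\widetilde T)x+t_4(x,\widetilde W)y\le t_2(x,\widetilde h)$. Then the continuous relaxation of the transformed second-stage program is convex.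
   Context: Two-stage stochastic mixed-integer linear program with decision-dependent probability: $\mathcal X\subseteq\mathbb R^{n_1}_+$ and $\mathcal Y\subseteq\mathbb R^{n_2}_+$ are compact sets imposing non-negativity and continuous, integer or binary restrictions. The second-stage data $\xi^{\top}=(q^{\top},h^{\top},T,W)$ have a distribution depending on the first-stage decision $x$; $\boldsymbol\xi_x$ denotes a random vector with the conditional distribution of $\boldsymbol\xi$ given $x$, and $\boldsymbol\xi_x^u$ its $u$-th random element. $\boldsymbol\vartheta$, with $\boldsymbol\vartheta^{\top}=(\widetilde q^{\top},\widetilde h,\widetilde T,\widetilde W)$, is a random vector whose distribution is independent of $x$, and $t(x,\boldsymbol\vartheta)=(t_1(x,\widetilde q^{\top}),t_2(x,\widetilde h),t_3(x,\widetilde T),t_4(x,\widetilde W))$ is a transformation function with $\boldsymbol\xi_x=t(x,\boldsymbol\vartheta)$, returning respectively $q_x^{\top},h_x,T_x,W_x$. Each random component of $h_x$ is thus of the form $t(x,\boldsymbol\vartheta_u)$ for the corresponding $u$; non-random components of $h$ are constants. $\mathbb F_{\boldsymbol\xi^u}(x,\beta)(\cdot)$ is the conditional marginal cumulative distribution function of $\boldsymbol\xi^u$ given $x$, where $\beta$ denotes the remaining distribution parameters that are not decisions. Its generalized inverse is $\mathbb F^{-1}_{\boldsymbol\xi^u}(x,\beta)(j)=\min\{\xi\in\Xi_x:\ \mathbb F_{\boldsymbol\xi^u}(x,\beta)(\xi)\ge j\}$, where $\Xi_x$ is the support of the variable given $x$; under condition (2) it is the ordinary inverse function. "The continuous relaxation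 of the transformed second-stage program is convex" means: with integrality dropped in $\mathcal X$ and $\mathcal Y$ (giving convex sets $\overline{\mathcal X},\overline{\mathcal Y}$), for each realization $\vartheta$ the objective is a convex function of $(x,y)$ and the set of $(x,y)\in\overline{\mathcal X}\times\overline{\mathcal Y}$ satisfying the recourse constraint is convex. *)

theory Defs
  imports "HOL-Probability.Probability"
begin

section \<open>Mixed-integer domains and their continuous relaxations\<close>

text \<open>
  A domain consists of the nonnegative points of a base set (bounds and any further continuous
  restrictions) whose listed coordinates are integer, respectively binary.  Dropping integrality
  turns a binary coordinate into one ranging over the unit interval.
\<close>

record ('n::finite) mi_domain =
  base :: "(real ^ 'n) set"
  integers :: "'n set"
  binaries :: "'n set"

definition points :: "'n::finite mi_domain \<Rightarrow> (real ^ 'n) set" where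
  "points D = {x \<in> base D. (\<forall>i. 0 \<le> x $ i) \<and>
     (\<forall>i \<in> integers D. x $ i \<in> \<int>) \<and> (\<forall>i \<in> binaries D. x $ i \<in> {0, 1})}"

definition relaxed_points :: "'n::finite mi_domain \<Rightarrow> (real ^ 'n) set" where
  "relaxed_points D = {x \<in> base D. (\<forall>i. 0 \<le> x $ i) \<and> (\<forall>i \<in> binaries D. x $ i \<le> 1)}"

section \<open>Second-stage data, conditional marginals and the generalized inverse\<close>

text \<open>
  Data are tuples \<open>(q, h, T, W)\<close>: cost vector, right-hand side, technology matrix and recourse
  matrix.  The index types \<open>'n\<close>, \<open>'p\<close>, \<open>'m\<close> stand for the first-stage variables, the
  second-stage variables and the rows of the recourse constraint.
\<close>

type_synonym ('n, 'p, 'm) data =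
  "(real ^ 'p) \<times> (real ^ 'm) \<times> (real ^ 'n ^ 'm) \<times> (real ^ 'p ^ 'm)"

definition rhs :: "('n::finite, 'p::finite, 'm::finite) data \<Rightarrow> real ^ 'm" where
  "rhs \<xi> = fst (snd \<xi>)"

definition rhs_marginal ::
    "('n::finite, 'p::finite, 'm::finite) data measure \<Rightarrow> 'm \<Rightarrow> real measure" where
  "rhs_marginal P u = distr P borel (\<lambda>\<xi>. rhs \<xi> $ u)"

text \<open>
  \<open>P x \<beta>\<close> is the conditional law of the data given the decision \<open>x\<close>, with \<open>\<beta>\<close> the remaining
  distribution parameters.
\<close>

definition marginal_cdf ::
    "(real ^ 'n \<Rightarrow> 'b \<Rightarrow> ('n::finite, 'p::finite, 'm::finite) data measure) \<Rightarrow>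
     'm \<Rightarrow> real ^ 'n \<Rightarrow> 'b \<Rightarrow> real \<Rightarrow> real" where
  "marginal_cdf P u x \<beta> = cdf (rhs_marginal (P x \<beta>) u)"

definition marginal_support ::
    "(real ^ 'n \<Rightarrow> 'b \<Rightarrow> ('n::finite, 'p::finite, 'm::finite) data measure) \<Rightarrow>
     'm \<Rightarrow> real ^ 'n \<Rightarrow> 'b \<Rightarrow> real set" where
  "marginal_support P u x \<beta> = {z. \<forall>S. open S \<longrightarrow> z \<in> S \<longrightarrow> emeasure (rhs_marginal (P x \<beta>) u) S > 0}"

definition inverse_cdf ::
    "(real ^ 'n \<Rightarrow> 'b \<Rightarrow> ('n::finite, 'p::finite, 'm::finite) data measure) \<Rightarrow>
     'm \<Rightarrow> real ^ 'n \<Rightarrow> 'b \<Rightarrow> real \<Rightarrow> real" where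
  "inverse_cdf P u x \<beta> j = (LEAST z. z \<in> marginal_support P u x \<beta> \<and> marginal_cdf P u x \<beta> z \<ge> j)"

definition transform ::
    "(real ^ 'n \<Rightarrow> real ^ 'p \<Rightarrow> real ^ 'p) \<Rightarrow> (real ^ 'n \<Rightarrow> real ^ 'm \<Rightarrow> real ^ 'm) \<Rightarrow>
     (real ^ 'n \<Rightarrow> real ^ 'n ^ 'm \<Rightarrow> real ^ 'n ^ 'm) \<Rightarrow> (real ^ 'n \<Rightarrow> real ^ 'p ^ 'm \<Rightarrow> real ^ 'p ^ 'm) \<Rightarrow>
     real ^ 'n \<Rightarrow> ('n::finite, 'p::finite, 'm::finite) data \<Rightarrow> ('n, 'p, 'm) data" where
  "transform t1 t2 t3 t4 x = (\<lambda>(q, h, T, W). (t1 x q, t2 x h, t3 x T, t4 x W))"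

section \<open>The second-stage program\<close>

definition second_stage_objective ::
    "('n::finite, 'p::finite, 'm::finite) data \<Rightarrow> real ^ 'p \<Rightarrow> real" where
  "second_stage_objective = (\<lambda>(q, h, T, W) y. q \<bullet> y)"

text \<open>
  The relation \<open>R\<close> is the sense of the recourse constraint; on vectors, \<open>(\<ge>)\<close> and \<open>(\<le>)\<close> are
  the componentwise orders.
\<close>

definition recourse_constraint ::
    "(real ^ 'm \<Rightarrow> real ^ 'm \<Rightarrow> bool) \<Rightarrow> ('n::finite, 'p::finite, 'm::finite) data \<Rightarrow>
     real ^ 'n \<Rightarrow> real ^ 'p \<Rightarrow> bool" where
  "recourse_constraint R = (\<lambda>(q, h, T, W) x y. R (T *v x + W *v y) h)"

text \<open>
  Here \<open>t x \<theta>\<close> is the data of the program at first-stage decision \<open>x\<close> and realization \<open>\<theta>\<close>.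
  Convexity is joint in \<open>(x, y)\<close>.
\<close>

definition convex_continuous_relaxation ::
    "(real ^ 'm \<Rightarrow> real ^ 'm \<Rightarrow> bool) \<Rightarrow> 'n mi_domain \<Rightarrow> 'p mi_domain \<Rightarrow>
     (real ^ 'n \<Rightarrow> ('n, 'p, 'm) data \<Rightarrow> ('n::finite, 'p::finite, 'm::finite) data) \<Rightarrow>
     ('n, 'p, 'm) data \<Rightarrow> bool" where
  "convex_continuous_relaxation R X Y t \<theta> \<longleftrightarrow>
     convex_on (relaxed_points X \<times> relaxed_points Y)
       (\<lambda>(x, y). second_stage_objective (t x \<theta>) y) \<and>
     convex {(x, y). x \<in> relaxed_points X \<and> y \<in> relaxed_points Y \<and>
       recourse_constraint R (t x \<theta>) x y}"

end

theory Submission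
  imports Defs
begin

text \<open>
  With costs and matrices fixed, the decision enters the transformed program nonlinearly only
  through the right-hand side \<open>t2 x h\<close>.  The objective is linear in \<open>(x, y)\<close>.  For a fixed
  realization, row \<open>u\<close> of a greater-or-equal recourse constraint says that a function of the
  decision alone, namely a constant or a quantile function evaluated at the realization, is at
  most a linear function of \<open>(x, y)\<close>; hence the points satisfying it form a sublevel set of a
  convex function as soon as the quantile function is convex in the decision.  The less-or-equal
  constraint is the same one after negating both sides, which turns concavity into convexity.

  The argument is carried by \<open>convex_componentwise_epigraph\<close> for the constraint and
  \<open>convex_continuous_relaxation_intro\<close>, which reduces the program to it.
\<close>

lemma convex_on_cong:
  assumes "\<And>x. x \<in> A \<Longrightarrow> f x = g x"
  shows "convex_on A f \<longleftrightarrow> convex_on A g"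
  using assms by (auto simp: convex_on_def convex_def)

lemma convex_relaxed_points:
  assumes "convex (base D)"
  shows "convex (relaxed_points D)"
proof -
  have "relaxed_points D =
      base D \<inter> (\<Inter>i. {x. x $ i \<ge> 0}) \<inter> (\<Inter>i\<in>binaries D. {x. x $ i \<le> 1})"
    by (auto simp: relaxed_points_def)
  moreover have "convex {x :: real ^ 'a. x $ i \<ge> 0}" for i
    by (simp add: convex_def)
  moreover have "convex {x :: real ^ 'a. x $ i \<le> 1}" for i
    by (simp add: convex_def convex_bound_le)
  ultimately show ?thesis
    using assms by (simp add: convex_Int convex_INT)
qed

text \<open>
  The set is the intersection over the coordinates \<open>u\<close> of the sublevel sets at \<open>0\<close> of
  \<open>\<lambda>(x, y). g x $ u - L (x, y) $ u\<close>, each convex because subtracting a linear function from a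
  convex one keeps it convex.  Taking \<open>L\<close> as an arbitrary linear map lets \<open>g\<close> and \<open>L\<close> be
  negated together, which covers both senses of the constraint.
\<close>

lemma convex_componentwise_epigraph:
  fixes g :: "'a::real_vector \<Rightarrow> real ^ 'm::finite"
    and L :: "'a \<times> 'c::real_vector \<Rightarrow> real ^ 'm"
  assumes "convex B" and g: "\<And>u. convex_on A (\<lambda>x. g x $ u)" and L: "linear L"
  shows "convex {(x, y). x \<in> A \<and> y \<in> B \<and> g x \<le> L (x, y)}"
proof (rule convexI)
  fix z z' :: "'a \<times> 'c" and a b :: real
  assume z: "z \<in> {(x, y). x \<in> A \<and> y \<in> B \<and> g x \<le> L (x, y)}"
    and z': "z' \<in> {(x, y). x \<in> A \<and> y \<in> B \<and> g x \<le> L (x, y)}"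
    and ab: "0 \<le> a" "0 \<le> b" "a + b = 1"
  obtain x y x' y' where eq: "z = (x, y)" "z' = (x', y')"
    by fastforce
  have "convex A"
    using g convex_on_imp_convex by blast
  then have A: "a *\<^sub>R x + b *\<^sub>R x' \<in> A" and B: "a *\<^sub>R y + b *\<^sub>R y' \<in> B"
    using z z' ab eq \<open>convex B\<close> by (auto simp: convex_def)
  have "g (a *\<^sub>R x + b *\<^sub>R x') $ u \<le> L (a *\<^sub>R z + b *\<^sub>R z') $ u" for u
  proof -
    have "g (a *\<^sub>R x + b *\<^sub>R x') $ u \<le> a * g x $ u + b * g x' $ u"
      using g[of u] z z' ab eq by (auto simp: convex_on_def)
    also have "\<dots> \<le> a * L z $ u + b * L z' $ u"
      using z z' ab eq by (auto intro!: add_mono mult_left_mono simp: less_eq_vec_def)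
    also have "\<dots> = L (a *\<^sub>R z + b *\<^sub>R z') $ u"
      by (simp add: linear_add[OF L] linear_cmul[OF L])
    finally show ?thesis .
  qed
  then show "a *\<^sub>R z + b *\<^sub>R z' \<in> {(x, y). x \<in> A \<and> y \<in> B \<and> g x \<le> L (x, y)}"
    using A B eq by (simp add: less_eq_vec_def)
qed

text \<open>
  Convexity of both the objective and the feasible set is a statement about points of the relaxed
  domains only, so it suffices to know the transformation there: fixed data apart from an
  arbitrary decision-dependent right-hand side \<open>g\<close>.
\<close>

lemma convex_continuous_relaxation_intro:
  fixes W :: "real ^ 'p::finite ^ 'm::finite" and T :: "real ^ 'n::finite ^ 'm"
  assumes "convex (relaxed_points X)" "convex (relaxed_points Y)"
    and t: "\<And>x. x \<in> relaxed_points X \<Longrightarrow> t x \<theta> = (q, g x, T, W)"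
    and feasible: "convex {(x, y). x \<in> relaxed_points X \<and> y \<in> relaxed_points Y \<and>
      R (T *v x + W *v y) (g x)}"
  shows "convex_continuous_relaxation R X Y t \<theta>"
proof -
  have "convex_on (relaxed_points X \<times> relaxed_points Y) (\<lambda>(x, y). q \<bullet> y)"
    using assms(1,2) by (auto simp: convex_on_def convex_Times inner_add_right)
  then have "convex_on (relaxed_points X \<times> relaxed_points Y)
      (\<lambda>(x, y). second_stage_objective (t x \<theta>) y)"
    by (rule convex_on_cong[THEN iffD1, rotated]) (auto simp: t second_stage_objective_def)
  moreover have "{(x, y). x \<in> relaxed_points X \<and> y \<in> relaxed_points Y \<and>
        recourse_constraint R (t x \<theta>) x y} =
      {(x, y). x \<in> relaxed_points X \<and> y \<in> relaxed_points Y \<and> R (T *v x + W *v y) (g x)}"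
    by (auto simp: t recourse_constraint_def)
  ultimately show ?thesis
    using feasible by (simp add: convex_continuous_relaxation_def)
qed

lemma linear_recourse_map: "linear (\<lambda>(x, y). T *v x + W *v y)"
  for T :: "real ^ 'n::finite ^ 'm::finite" and W :: "real ^ 'p::finite ^ 'm"
  by (rule linearI)
    (auto simp: matrix_vector_right_distrib matrix_vector_mult_scaleR scaleR_add_right)

theorem theorem2:
  fixes X :: "'n::finite mi_domain"
    and Y :: "'p::finite mi_domain"
    and U :: "'m::finite set"
    and P :: "real ^ 'n \<Rightarrow> 'b \<Rightarrow> ('n, 'p, 'm) data measure"
    and \<beta> :: 'b
    and M :: "'w measure"
    and \<Theta> :: "'w \<Rightarrow> ('n, 'p, 'm) data"
    and t1 :: "real ^ 'n \<Rightarrow> real ^ 'p \<Rightarrow> real ^ 'p"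
    and t2 :: "real ^ 'n \<Rightarrow> real ^ 'm \<Rightarrow> real ^ 'm"
    and t3 :: "real ^ 'n \<Rightarrow> real ^ 'n ^ 'm \<Rightarrow> real ^ 'n ^ 'm"
    and t4 :: "real ^ 'n \<Rightarrow> real ^ 'p ^ 'm \<Rightarrow> real ^ 'p ^ 'm"
    and q :: "real ^ 'p"
    and T :: "real ^ 'n ^ 'm"
    and W :: "real ^ 'p ^ 'm"
    and c :: "real ^ 'm"
  assumes compact: "compact (points X)" "compact (points Y)"
    and convex_base: "convex (base X)" "convex (base Y)"
    and exogenous: "prob_space M" "\<Theta> \<in> borel_measurable M"
    and uniform: "\<And>u. u \<in> U \<Longrightarrow>
          distr M borel (\<lambda>\<omega>. rhs (\<Theta> \<omega>) $ u) = uniform_measure lborel {0<..<1}"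
    and conditional_law: "\<And>x. x \<in> relaxed_points X \<Longrightarrow> prob_space (P x \<beta>)"
          "\<And>x. x \<in> relaxed_points X \<Longrightarrow> (\<lambda>\<omega>. transform t1 t2 t3 t4 x (\<Theta> \<omega>)) \<in> borel_measurable M"
          "\<And>x. x \<in> relaxed_points X \<Longrightarrow> distr M borel (\<lambda>\<omega>. transform t1 t2 t3 t4 x (\<Theta> \<omega>)) = P x \<beta>"
    and inverse_transformation: "\<And>x u h. x \<in> relaxed_points X \<Longrightarrow> u \<in> U \<Longrightarrow>
          h $ u \<in> {0<..<1} \<Longrightarrow> t2 x h $ u = inverse_cdf P u x \<beta> (h $ u)"
    and nonrandom_rhs: "\<And>x u h. x \<in> relaxed_points X \<Longrightarrow> u \<notin> U \<Longrightarrow> t2 x h $ u = c $ u"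
    and fixed_data: "\<And>x q'. x \<in> relaxed_points X \<Longrightarrow> t1 x q' = q"
          "\<And>x T'. x \<in> relaxed_points X \<Longrightarrow> t3 x T' = T"
          "\<And>x W'. x \<in> relaxed_points X \<Longrightarrow> t4 x W' = W"
    and cdf_continuous: "\<And>x u. x \<in> relaxed_points X \<Longrightarrow> u \<in> U \<Longrightarrow>
          continuous_on UNIV (marginal_cdf P u x \<beta>)"
    and cdf_strict_mono: "\<And>x u. x \<in> relaxed_points X \<Longrightarrow> u \<in> U \<Longrightarrow>
          strict_mono_on (marginal_support P u x \<beta>) (marginal_cdf P u x \<beta>)"
  shows "((\<forall>u\<in>U. \<forall>v\<in>{0<..<1}. convex_on (relaxed_points X) (\<lambda>x. inverse_cdf P u x \<beta> v)) \<longrightarrow>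
           (\<forall>\<theta>. (\<forall>u\<in>U. rhs \<theta> $ u \<in> {0<..<1}) \<longrightarrow>
              convex_continuous_relaxation (\<ge>) X Y (transform t1 t2 t3 t4) \<theta>)) \<and>
         ((\<forall>u\<in>U. \<forall>v\<in>{0<..<1}. concave_on (relaxed_points X) (\<lambda>x. inverse_cdf P u x \<beta> v)) \<longrightarrow>
           (\<forall>\<theta>. (\<forall>u\<in>U. rhs \<theta> $ u \<in> {0<..<1}) \<longrightarrow>
              convex_continuous_relaxation (\<le>) X Y (transform t1 t2 t3 t4) \<theta>))"
proof -
  have X: "convex (relaxed_points X)" and Y: "convex (relaxed_points Y)"
    using convex_base by (simp_all add: convex_relaxed_points)
  have t: "transform t1 t2 t3 t4 x \<theta> = (q, t2 x (rhs \<theta>), T, W)"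
    if "x \<in> relaxed_points X" for x \<theta>
    using that by (simp add: transform_def rhs_def fixed_data split: prod.split)
  \<comment> \<open>The sign \<open>s\<close> is \<open>1\<close> for the greater-or-equal constraint and \<open>-1\<close> for the less-or-equal one.\<close>
  have row: "convex_on (relaxed_points X) (\<lambda>x. s * t2 x (rhs \<theta>) $ u)"
    if quantile: "\<forall>u\<in>U. \<forall>v\<in>{0<..<1}. convex_on (relaxed_points X) (\<lambda>x. s * inverse_cdf P u x \<beta> v)"
      and \<theta>: "\<forall>u\<in>U. rhs \<theta> $ u \<in> {0<..<1}" for s \<theta> u
  proof (cases "u \<in> U")
    case True
    then have "convex_on (relaxed_points X) (\<lambda>x. s * inverse_cdf P u x \<beta> (rhs \<theta> $ u))"
      using quantile \<theta> by blast
    then show ?thesis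
      by (rule convex_on_cong[THEN iffD1, rotated])
        (use True \<theta> in \<open>simp add: inverse_transformation\<close>)
  next
    case False
    have "convex_on (relaxed_points X) (\<lambda>x. s * c $ u)"
      using X by (simp add: convex_on_const)
    then show ?thesis
      by (rule convex_on_cong[THEN iffD1, rotated]) (use False in \<open>simp add: nonrandom_rhs\<close>)
  qed
  show ?thesis
  proof (intro conjI impI allI)
    fix \<theta> :: "('n, 'p, 'm) data"
    assume quantile: "\<forall>u\<in>U. \<forall>v\<in>{0<..<1}. convex_on (relaxed_points X) (\<lambda>x. inverse_cdf P u x \<beta> v)"
      and \<theta>: "\<forall>u\<in>U. rhs \<theta> $ u \<in> {0<..<1}"
    have "convex_on (relaxed_points X) (\<lambda>x. t2 x (rhs \<theta>) $ u)" for u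
      using row[of 1] quantile \<theta> by simp
    from convex_componentwise_epigraph[OF Y this linear_recourse_map]
    show "convex_continuous_relaxation (\<ge>) X Y (transform t1 t2 t3 t4) \<theta>"
      using t
      by (intro convex_continuous_relaxation_intro[OF X Y, where q = q and T = T and W = W
            and g = "\<lambda>x. t2 x (rhs \<theta>)"]) auto
  next
    fix \<theta> :: "('n, 'p, 'm) data"
    assume quantile: "\<forall>u\<in>U. \<forall>v\<in>{0<..<1}. concave_on (relaxed_points X) (\<lambda>x. inverse_cdf P u x \<beta> v)"
      and \<theta>: "\<forall>u\<in>U. rhs \<theta> $ u \<in> {0<..<1}"
    have "convex_on (relaxed_points X) (\<lambda>x. (- t2 x (rhs \<theta>)) $ u)" for u
      using row[of "-1"] quantile \<theta> by (simp add: concave_on_def)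
    moreover have "- a \<le> - b - d \<longleftrightarrow> b + d \<le> a" for a b d :: real
      by linarith
    moreover note convex_componentwise_epigraph[OF Y calculation(1)
        linear_compose_neg[OF linear_recourse_map[of T W]]]
    ultimately have "convex {(x, y). x \<in> relaxed_points X \<and> y \<in> relaxed_points Y \<and>
        T *v x + W *v y \<le> t2 x (rhs \<theta>)}"
      by (simp add: less_eq_vec_def)
    then show "convex_continuous_relaxation (\<le>) X Y (transform t1 t2 t3 t4) \<theta>"
      using t
      by (intro convex_continuous_relaxation_intro[OF X Y, where q = q and T = T and W = W
            and g = "\<lambda>x. t2 x (rhs \<theta>)"]) auto
  qed
qed

end
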